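(* There exist $M\in\mathbb{N}$ and a nonempty set $A\subset\mathbb{Z}_M$ such that $A$ satisfies (T1), $M$ has two distinct prime divisors, and $A(X)$ has at least one unsupported cyclotomic divisor.
   Context: $\mathbb{Z}_M=\mathbb{Z}/M\mathbb{Z}$. For $A\subset\mathbb{Z}_M$, represent its elements by integers in $\{0,1,\dots,M-1\}$; the mask polynomial is $A(X)=\sum_{a\in A}X^a$, considered modulo $X^M-1$. For $s\mid M$, divisibility of $A(X)$ by the $s$-th cyclotomic polynomial $\Phi_s(X)$ is well defined, since $\Phi_s\mid X^M-1$; all cyclotomic divisors $\Phi_s$ considered have $s\mid M$. "$M$ has two distinct prime divisors" means exactly two. $S_A^*$ is the set of all prime powers $p^\alpha>1$ (with $p^\alpha\mid M$) such that $\Phi_{p^\alpha}(X)\mid A(X)$. Condition (T1): $|A|=\prod_{s\in S_A^*}\Phi_s(1)$. If $s\neq1$ and $\Phi_s\mid A$, then $\Phi_s$ is called an unsupported divisor of $A$ if (i) for every prime $p\mid s$ we have $p\mid |A|$, and (ii) for every prime power $p^\alpha$ with $p^\alpha\parallel s$ (i.e. $p$ is a prime dividing $s$, $p^\alpha\mid s$ and $p^{\alpha+1}\nmid s$), we have $\Phi_{p^\alpha}\nmid A$. *)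

theory Defs
  imports
    Complex_Main
    "HOL-Computational_Algebra.Polynomial"
    "HOL-Number_Theory.Totient"
    "HOL-Number_Theory.Prime_Powers"
begin

text \<open>
  Polynomials are taken over the complex numbers. Every cyclotomic polynomial is monic with
  integer coefficients, so it divides a polynomial with integer coefficients over the complex
  numbers exactly when it does so over the integers.
\<close>

definition cyclotomic :: "nat \<Rightarrow> complex poly" where
  "cyclotomic s = (\<Prod>k\<in>totatives s. [:- cis (2 * pi * real k / real s), 1:])"

text \<open>
  A subset of the integers mod \<open>M\<close> is represented by the set of its residues, a subset of
  \<open>{0..<M}\<close>; the mask polynomial is then the canonical representative modulo \<open>X ^ M - 1\<close>.
\<close>

definition mask_poly :: "nat set \<Rightarrow> complex poly" where
  "mask_poly A = (\<Sum>a\<in>A. monom 1 a)"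

definition prime_power_divisors :: "nat \<Rightarrow> nat set \<Rightarrow> nat set" where
  "prime_power_divisors M A = {s. primepow s \<and> s dvd M \<and> cyclotomic s dvd mask_poly A}"

definition T1 :: "nat \<Rightarrow> nat set \<Rightarrow> bool" where
  "T1 M A \<longleftrightarrow> of_nat (card A) = (\<Prod>s\<in>prime_power_divisors M A. poly (cyclotomic s) 1)"

text \<open>\<open>unsupported_divisor M A s\<close>: the polynomial \<open>cyclotomic s\<close> is an unsupported divisor of \<open>A\<close>.\<close>

definition unsupported_divisor :: "nat \<Rightarrow> nat set \<Rightarrow> nat \<Rightarrow> bool" where
  "unsupported_divisor M A s \<longleftrightarrow>
     s dvd M \<and> s \<noteq> 1 \<and> cyclotomic s dvd mask_poly A \<and>
     (\<forall>p. prime p \<and> p dvd s \<longrightarrow> p dvd card A) \<and>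
     (\<forall>p \<alpha>. prime p \<and> p dvd s \<and> p ^ \<alpha> dvd s \<and> \<not> p ^ (\<alpha> + 1) dvd s \<longrightarrow>
        \<not> cyclotomic (p ^ \<alpha>) dvd mask_poly A)"

end

theory Submission
  imports Defs
begin

text \<open>
  The example lives in \<open>\<int>\<^sub>M\<close> with \<open>M = 432 = 2\<^sup>4 \<cdot> 3\<^sup>3\<close>. Take a disjoint union \<open>A\<close> of \<open>9\<close> cosets of
  the subgroup of order \<open>2\<close> and \<open>18\<close> cosets of the subgroup of order \<open>3\<close>, so that \<open>\<Phi>\<^sub>M\<close> divides
  the mask polynomial. Modulo \<open>16\<close> only the cosets of order \<open>3\<close> contribute to the value at a
  primitive root of unity, and modulo \<open>27\<close> only those of order \<open>2\<close>; placing the residues in a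
  half circle makes these values nonzero, so neither \<open>\<Phi>\<^sub>1\<^sub>6\<close> nor \<open>\<Phi>\<^sub>2\<^sub>7\<close> divides. The cosets can
  still be balanced to make \<open>A\<close> equidistributed modulo \<open>8\<close> and modulo \<open>9\<close>, where a coset of
  order \<open>2\<close> counts twice and one of order \<open>3\<close> counts three times. So the prime power
  divisors are \<open>\<Phi>\<^sub>2\<close>, \<open>\<Phi>\<^sub>4\<close>, \<open>\<Phi>\<^sub>8\<close>, \<open>\<Phi>\<^sub>3\<close>, \<open>\<Phi>\<^sub>9\<close>, in accordance with \<open>card A = 72 = 2\<^sup>3 \<cdot> 3\<^sup>2\<close>.
\<close>

section \<open>Divisibility by cyclotomic polynomials through roots of unity\<close>

lemma prod_linear_factors_dvd:
  fixes f :: "'a :: idom poly"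
  assumes "finite K" "inj_on r K" "\<And>k. k \<in> K \<Longrightarrow> poly f (r k) = 0"
  shows "(\<Prod>k\<in>K. [:- r k, 1:]) dvd f"
  using assms
proof (induction K arbitrary: f rule: finite_induct)
  case (insert k K)
  have "[:- r k, 1:] dvd f"
    using insert.prems by (simp add: poly_eq_0_iff_dvd [symmetric])
  then obtain g where f: "f = [:- r k, 1:] * g" ..
  \<comment> \<open>Since \<open>r j\<close> differs from \<open>r k\<close>, the extracted factor
    is nonzero there and the quotient inherits the root.\<close>
  have "poly g (r j) = 0" if "j \<in> K" for j
    using insert.prems(2)[of j] inj_onD[OF insert.prems(1), of j k] insert.hyps(2) that
    by (auto simp: f)
  then have "(\<Prod>j\<in>K. [:- r j, 1:]) dvd g"
    using insert.IH insert.prems(1) by simp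
  then show ?case
    unfolding f prod.insert[OF insert.hyps] by (rule mult_dvd_mono[OF dvd_refl])
qed simp

lemma power_mod_eq:
  fixes z :: "'a :: monoid_mult"
  assumes "z ^ n = 1"
  shows "z ^ (a mod n) = z ^ a"
proof -
  have "z ^ a = (z ^ n) ^ (a div n) * z ^ (a mod n)"
    by (simp flip: power_add power_mult)
  then show ?thesis by (simp add: assms)
qed

text \<open>Powers of \<open>cis (2 * pi / s)\<close> with exponents below \<open>s\<close> are
  distinct, and \<open>k\<close> cancels from \<open>s dvd k * m\<close> by coprimality.\<close>

lemma cis_power_eq_1_iff:
  assumes "s > 0" "coprime k s"
  shows "cis (2 * pi * real k / real s) ^ m = 1 \<longleftrightarrow> s dvd m"
proof -
  define w where "w = cis (2 * pi / real s)"
  have w: "cis (2 * pi * real j / real s) = w ^ j" for j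
    by (simp add: w_def Complex.DeMoivre mult_ac)
  have "w ^ s = 1"
    using assms(1) by (simp add: w_def Complex.DeMoivre)
  then have "cis (2 * pi * real k / real s) ^ m = 1 \<longleftrightarrow> w ^ (k * m mod s) = w ^ 0"
    by (simp add: w power_mod_eq flip: power_mult)
  also have "\<dots> \<longleftrightarrow> k * m mod s = 0"
    using bij_betw_imp_inj_on[OF bij_betw_roots_unity[OF assms(1)]] assms(1)
    unfolding w by (intro inj_on_eq_iff[of "(^) w" "{..<s}"]) auto
  also have "\<dots> \<longleftrightarrow> s dvd m"
    using assms(2) by (simp add: mod_eq_0_iff_dvd coprime_commute coprime_dvd_mult_right_iff)
  finally show ?thesis .
qed

text \<open>The roots are simple, so vanishing at each suffices. The premise on \<open>z\<close>
  says that its multiplicative order is exactly \<open>s\<close>.\<close>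

lemma cyclotomic_dvdI:
  assumes "\<And>z. (\<And>m. z ^ m = 1 \<longleftrightarrow> s dvd m) \<Longrightarrow> poly f z = 0"
  shows "cyclotomic s dvd f"
proof -
  have "inj_on (\<lambda>k. cis (2 * pi * real k / real s)) (totatives s)"
  proof (cases "s > 1")
    case True
    then show ?thesis
      using bij_betw_imp_inj_on[OF bij_betw_roots_unity, of s]
      by (rule_tac inj_on_subset) (auto simp: totatives_less)
  next
    \<comment> \<open>The element of \<open>totatives 1 = {1}\<close> lies outside
      \<open>{..<1}\<close>, so the previous argument does not cover this case.\<close>
    case False
    then have "s = 0 \<or> s = 1" by auto
    then show ?thesis by auto
  qed
  then show ?thesis
    unfolding cyclotomic_def
    by (intro prod_linear_factors_dvd assms)
       (auto simp: in_totatives_iff intro!: cis_power_eq_1_iff)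
qed

lemma cyclotomic_dvd_imp_root:
  assumes "cyclotomic s dvd f" "s > 0"
  shows "poly f (cis (2 * pi / real s)) = 0"
proof -
  have "poly (cyclotomic s) (cis (2 * pi / real s)) = 0"
    using assms(2) unfolding cyclotomic_def poly_prod
    by (intro prod_zero) (auto intro!: bexI[of _ 1])
  with assms(1) show ?thesis by (auto elim!: dvdE)
qed

lemma degree_cyclotomic: "degree (cyclotomic s) = totient s"
  by (simp add: cyclotomic_def degree_prod_eq_sum_degree totient_def)

lemma lead_coeff_cyclotomic: "lead_coeff (cyclotomic s) = 1"
  by (simp add: cyclotomic_def lead_coeff_prod)

section \<open>Prime power cyclotomic polynomials and their values at 1\<close>

text \<open>Divisibility follows from the roots; both sides are monic of degree
  \<open>(p - 1) * p ^ n\<close>, so the quotient is 1.\<close>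

lemma cyclotomic_prime_power:
  assumes p: "prime p"
  shows "cyclotomic (p ^ Suc n) = (\<Sum>i<p. monom 1 (i * p ^ n))" (is "_ = ?f")
proof -
  define q where "q = p ^ n"
  have [simp]: "q > 0" using p by (simp add: q_def prime_gt_0_nat)
  obtain r where r: "p = Suc r" "r > 0"
    using prime_gt_1_nat[OF p] by (cases p) auto
  have "degree (\<Sum>i<r. monom (1::complex) (i * q)) < r * q"
    using r by (intro degree_sum_less) (auto simp: degree_monom_eq)
  moreover have "?f = (\<Sum>i<r. monom 1 (i * q)) + monom 1 (r * q)"
    by (simp only: r(1) sum.lessThan_Suc q_def)
  ultimately have f: "degree ?f = r * q" "lead_coeff ?f = 1"
    by (simp_all add: degree_add_eq_right degree_monom_eq coeff_eq_0)
  have "cyclotomic (p ^ Suc n) dvd ?f"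
  proof (rule cyclotomic_dvdI)
    fix z :: complex
    assume z: "\<And>m. z ^ m = 1 \<longleftrightarrow> p ^ Suc n dvd m"
    \<comment> \<open>\<open>z ^ q\<close> is a nontrivial \<open>p\<close>-th root of unity, so its
      geometric sum vanishes.\<close>
    have "z ^ q \<noteq> 1"
      using prime_gt_1_nat[OF p] by (auto simp: z q_def dest!: dvd_imp_le)
    moreover have "(z ^ q) ^ p = 1"
      unfolding power_mult[symmetric] z by (simp add: q_def mult.commute)
    ultimately have "(\<Sum>i<p. (z ^ q) ^ i) = 0"
      by (simp add: geometric_sum)
    then show "poly ?f z = 0"
      by (simp add: poly_sum poly_monom q_def mult.commute flip: power_mult)
  qed
  then obtain g where g: "?f = cyclotomic (p ^ Suc n) * g" ..
  have "?f \<noteq> 0" using f(2) by auto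
  then have "cyclotomic (p ^ Suc n) \<noteq> 0" "g \<noteq> 0" using g by auto
  then have "degree ?f = totient (p ^ Suc n) + degree g"
    unfolding g by (simp add: degree_mult_eq degree_cyclotomic del: power_Suc)
  moreover have "totient (p ^ Suc n) = r * q"
    unfolding totient_prime_power_Suc[OF p] q_def by (simp add: r(1))
  ultimately have "degree g = 0"
    using f(1) by linarith
  moreover have "lead_coeff g = 1"
    using f(2) by (simp only: g lead_coeff_mult lead_coeff_cyclotomic mult_1)
  ultimately have "g = 1"
    by (metis degree_eq_zeroE lead_coeff_pCons(2) one_pCons)
  then show ?thesis using g by simp
qed

lemma poly_cyclotomic_prime_power_1:
  assumes "prime p"
  shows "poly (cyclotomic (p ^ Suc n)) 1 = of_nat p"
  by (simp add: cyclotomic_prime_power[OF assms] poly_sum poly_monom del: power_Suc)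

section \<open>The example set and its mask polynomial\<close>

text \<open>
  The smallest elements of the cosets, found by the Chinese remainder theorem. Those in
  \<open>starts2\<close> are congruent to \<open>j div 3\<close> modulo \<open>8\<close> and to \<open>j\<close> modulo \<open>27\<close>, for \<open>j = 0, \<dots>, 8\<close>. Those in
  \<open>starts3\<close> meet the classes \<open>0, 1, 2\<close> modulo \<open>16\<close> once and \<open>3, \<dots>, 7\<close> three times, and each
  class modulo \<open>9\<close> twice.
\<close>

definition starts2 :: "nat set" where
  "starts2 = {0, 34, 56, 57, 113, 114, 136, 170, 193}"

definition starts3 :: "nat set" where
  "starts3 = {3, 4, 7, 18, 20, 23, 33, 37, 48, 51, 70, 71, 85, 86, 99, 100, 101, 134}"

definition example_set :: "nat set" where
  "example_set = (starts2 \<union> (+) 216 ` starts2) \<union>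
     (starts3 \<union> (+) 144 ` starts3 \<union> (+) 288 ` starts3)"

lemma sum_example_set:
  fixes f :: "nat \<Rightarrow> 'a :: comm_monoid_add"
  shows "sum f example_set = (\<Sum>a\<in>starts2. f a + f (216 + a)) +
    (\<Sum>a\<in>starts3. f a + f (144 + a) + f (288 + a))"
proof -
  have fin: "finite starts2" "finite starts3"
    by (simp_all add: starts2_def starts3_def)
  have disj: "starts2 \<inter> (+) 216 ` starts2 = {}" "starts3 \<inter> (+) 144 ` starts3 = {}"
    "(starts3 \<union> (+) 144 ` starts3) \<inter> (+) 288 ` starts3 = {}"
    "(starts2 \<union> (+) 216 ` starts2) \<inter> (starts3 \<union> (+) 144 ` starts3 \<union> (+) 288 ` starts3) = {}"
    by (simp_all add: starts2_def starts3_def)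
  show ?thesis
    by (simp add: example_set_def sum.union_disjoint disj fin sum.reindex sum.distrib)
qed

lemma card_example_set: "card example_set = 72"
  unfolding card_eq_sum sum_example_set by (simp add: starts2_def starts3_def)

text \<open>The two factors are the mask polynomials of the subgroups of order 2 and 3.\<close>

lemma poly_mask_example_set:
  "poly (mask_poly example_set) z =
     (1 + z ^ 216) * (\<Sum>a\<in>starts2. z ^ a) + (1 + z ^ 144 + z ^ 288) * (\<Sum>a\<in>starts3. z ^ a)"
  by (simp add: mask_poly_def poly_sum poly_monom sum_example_set sum_distrib_left sum.distrib
        power_add distrib_right)

lemma sum_starts_mod:
  fixes z :: complex
  assumes "z ^ n = 1"
  shows "(\<Sum>a\<in>starts2. z ^ a) = (\<Sum>a\<in>starts2. z ^ (a mod n))"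
    and "(\<Sum>a\<in>starts3. z ^ a) = (\<Sum>a\<in>starts3. z ^ (a mod n))"
  by (simp_all add: power_mod_eq[OF assms])

section \<open>Zeros of the mask polynomial\<close>

lemma sum_powers_eq_0:
  fixes z :: complex
  assumes "z ^ n = 1" "z \<noteq> 1"
  shows "(\<Sum>i<n. z ^ i) = 0"
  using assms by (simp add: geometric_sum)

text \<open>Covers the orders 2, 4 and 8 at once. Each class modulo 8 has 9 elements: 3 * 2 + 1 * 3
  for the classes 0, 1, 2, and 3 * 3 for the others.\<close>

lemma mask_example_set_root_8:
  fixes z :: complex
  assumes z: "z ^ 8 = 1" "z \<noteq> 1"
  shows "poly (mask_poly example_set) z = 0"
proof -
  have "z ^ 216 = 1" "z ^ 144 = 1" "z ^ 288 = 1"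
    using power_mod_eq[OF z(1), of 216] power_mod_eq[OF z(1), of 144]
      power_mod_eq[OF z(1), of 288] by simp_all
  then have "poly (mask_poly example_set) z = 9 * (\<Sum>i<8. z ^ i)"
    unfolding poly_mask_example_set sum_starts_mod[OF z(1)]
    by (simp add: starts2_def starts3_def lessThan_nat_numeral algebra_simps)
       (simp add: eval_nat_numeral)
  then show ?thesis by (simp add: sum_powers_eq_0[OF z])
qed

text \<open>Covers the orders 3 and 9. Each class modulo 9 has 1 * 2 + 2 * 3 = 8 elements.\<close>

lemma mask_example_set_root_9:
  fixes z :: complex
  assumes z: "z ^ 9 = 1" "z \<noteq> 1"
  shows "poly (mask_poly example_set) z = 0"
proof -
  have "z ^ 216 = 1" "z ^ 144 = 1" "z ^ 288 = 1"
    using power_mod_eq[OF z(1), of 216] power_mod_eq[OF z(1), of 144]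
      power_mod_eq[OF z(1), of 288] by simp_all
  then have "poly (mask_poly example_set) z = 8 * (\<Sum>i<9. z ^ i)"
    unfolding poly_mask_example_set sum_starts_mod[OF z(1)]
    by (simp add: starts2_def starts3_def lessThan_nat_numeral algebra_simps)
       (simp add: eval_nat_numeral)
  then show ?thesis by (simp add: sum_powers_eq_0[OF z])
qed

text \<open>Here \<open>z ^ 216\<close> has order 2 and \<open>z ^ 144\<close> has order 3, so both
  subgroup factors vanish.\<close>

lemma cyclotomic_432_dvd_mask: "cyclotomic 432 dvd mask_poly example_set"
proof (rule cyclotomic_dvdI)
  fix z :: complex
  assume z: "\<And>m. z ^ m = 1 \<longleftrightarrow> 432 dvd m"
  have "(z ^ 216)\<^sup>2 = 1" "z ^ 216 \<noteq> 1"
    by (simp_all add: z flip: power_mult)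
  then have "z ^ 216 = - 1" by (metis power2_eq_1_iff)
  moreover have "(\<Sum>i<3. (z ^ 144) ^ i) = 0"
    by (rule sum_powers_eq_0) (simp_all add: z flip: power_mult)
  then have "1 + z ^ 144 + z ^ 288 = 0"
    by (simp add: lessThan_nat_numeral add_ac flip: power_mult)
  ultimately show "poly (mask_poly example_set) z = 0"
    by (simp add: poly_mask_example_set)
qed

section \<open>Nonvanishing at roots of order 16 and 27\<close>

text \<open>Exponents below \<open>n / 2\<close> give angles in [0, pi), so no imaginary part is
  negative and nothing cancels.\<close>

lemma Im_sum_cis_powers_pos:
  assumes "\<And>a. a \<in> K \<Longrightarrow> 2 * f a < n" "finite K" "k \<in> K" "f k > 0"
  shows "Im (\<Sum>a\<in>K. cis (2 * pi / real n) ^ f a) > 0"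
proof -
  have n: "n > 0" using assms(1)[OF assms(3)] by simp
  have Im: "Im (cis (2 * pi / real n) ^ f a) = sin (pi * (2 * real (f a) / real n))" for a
    by (simp add: Complex.DeMoivre mult_ac)
  have less: "2 * real (f a) / real n < 1" if "a \<in> K" for a
    using assms(1)[OF that] n by simp
  have "0 \<le> Im (cis (2 * pi / real n) ^ f a)" if "a \<in> K" for a
    unfolding Im using less[OF that] by (intro sin_ge_zero mult_left_le) simp_all
  moreover have "0 < Im (cis (2 * pi / real n) ^ f k)"
    unfolding Im using less[OF assms(3)] assms(4) n
      mult_strict_left_mono[OF less[OF assms(3)] pi_gt_zero]
    by (intro sin_gt_zero) simp_all
  ultimately show ?thesis
    unfolding Im_sum using assms(2,3) by (intro sum_pos2) auto
qed

lemma not_cyclotomic_16_dvd_mask: "\<not> cyclotomic 16 dvd mask_poly example_set"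
proof
  let ?z = "cis (2 * pi / real 16)"
  assume "cyclotomic 16 dvd mask_poly example_set"
  then have root: "poly (mask_poly example_set) ?z = 0"
    by (intro cyclotomic_dvd_imp_root) simp_all
  have z: "?z ^ m = 1 \<longleftrightarrow> 16 dvd m" for m
    using cis_power_eq_1_iff[of 16 1 m] by simp
  \<comment> \<open>As 216 is 8 modulo 16, the order 2 factor vanishes, leaving three times the sum
    over \<open>starts3\<close>.\<close>
  have "(?z ^ 216)\<^sup>2 = 1" "?z ^ 216 \<noteq> 1"
    unfolding power_mult[symmetric] z by simp_all
  then have "?z ^ 216 = - 1" by (metis power2_eq_1_iff)
  moreover have "?z ^ 144 = 1" "?z ^ 288 = 1" "?z ^ 16 = 1"
    unfolding z by simp_all
  ultimately have "(\<Sum>a\<in>starts3. ?z ^ (a mod 16)) = 0"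
    using root sum_starts_mod(2)[of ?z 16] unfolding poly_mask_example_set by simp
  moreover have "Im (\<Sum>a\<in>starts3. ?z ^ (a mod 16)) > 0"
    by (rule Im_sum_cis_powers_pos[where k = 4]) (auto simp: starts3_def)
  ultimately show False by simp
qed

lemma not_cyclotomic_27_dvd_mask: "\<not> cyclotomic 27 dvd mask_poly example_set"
proof
  let ?z = "cis (2 * pi / real 27)"
  assume "cyclotomic 27 dvd mask_poly example_set"
  then have root: "poly (mask_poly example_set) ?z = 0"
    by (intro cyclotomic_dvd_imp_root) simp_all
  have z: "?z ^ m = 1 \<longleftrightarrow> 27 dvd m" for m
    using cis_power_eq_1_iff[of 27 1 m] by simp
  have "?z ^ 216 = 1" "?z ^ 27 = 1"
    unfolding z by simp_all
  \<comment> \<open>As 144 is 9 modulo 27, \<open>?z ^ 144\<close> is a primitive cube root of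
    unity; only the sum over \<open>starts2\<close> survives, doubled.\<close>
  moreover have "(\<Sum>i<3. (?z ^ 144) ^ i) = 0"
    by (rule sum_powers_eq_0) (unfold power_mult[symmetric] z, simp_all)
  then have "1 + ?z ^ 144 + ?z ^ 288 = 0"
    by (simp add: lessThan_nat_numeral add_ac flip: power_mult)
  ultimately have "(\<Sum>a\<in>starts2. ?z ^ (a mod 27)) = 0"
    using root sum_starts_mod(1)[of ?z 27] unfolding poly_mask_example_set by simp
  moreover have "Im (\<Sum>a\<in>starts2. ?z ^ (a mod 27)) > 0"
    \<comment> \<open>The residues are 0 to 8, below 27 / 2; the witness 34 has the nonzero residue
      7.\<close>
    by (rule Im_sum_cis_powers_pos[where k = 34]) (auto simp: starts2_def)
  ultimately show False by simp
qed

section \<open>Prime power divisors, (T1) and the unsupported divisor\<close>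

lemma prime_dvd_432: "prime p \<Longrightarrow> p dvd 432 \<longleftrightarrow> p = 2 \<or> p = (3::nat)"
proof -
  assume p: "prime p"
  have "p dvd 432 \<longleftrightarrow> p dvd 2 ^ 4 * 3 ^ 3" by simp
  also have "\<dots> \<longleftrightarrow> p dvd 2 \<or> p dvd 3"
    using p by (simp only: prime_dvd_mult_iff prime_dvd_power_iff zero_less_numeral)
  also have "\<dots> \<longleftrightarrow> p = 2 \<or> p = 3"
    using p primes_dvd_imp_eq[of p 2] primes_dvd_imp_eq[of p 3] by auto
  finally show ?thesis .
qed

lemma two_power_dvd_432: "2 ^ k dvd (432::nat) \<longleftrightarrow> k \<le> 4"
proof -
  have "2 ^ k dvd 2 ^ 4 * (27::nat) \<longleftrightarrow> 2 ^ k dvd (2 ^ 4 :: nat)"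
    by (intro coprime_dvd_mult_left_iff) simp
  then show ?thesis using dvd_power_iff_le[of 2 k 4] by simp
qed

lemma three_power_dvd_432: "3 ^ k dvd (432::nat) \<longleftrightarrow> k \<le> 3"
proof -
  have "coprime (3 ^ k) (2 ^ 4 :: nat)"
    by (simp only: coprime_power_left_iff coprime_power_right_iff coprime_right_2_iff_odd) simp
  then have "3 ^ k dvd 3 ^ 3 * (2 ^ 4 :: nat) \<longleftrightarrow> 3 ^ k dvd (3 ^ 3 :: nat)"
    by (rule coprime_dvd_mult_left_iff)
  then show ?thesis using dvd_power_iff_le[of 3 k 3] by simp
qed

lemma prime_power_divisors_example_set:
  "prime_power_divisors 432 example_set = {2, 4, 8, 3, 9}"
proof (intro equalityI subsetI)
  fix s
  assume "s \<in> prime_power_divisors 432 example_set"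
  then have s: "primepow s" "s dvd 432" "cyclotomic s dvd mask_poly example_set"
    by (auto simp: prime_power_divisors_def)
  from s(1) obtain p k where pk: "prime p" "k > 0" "s = p ^ k"
    by (auto simp: primepow_def)
  have "p dvd 432" using pk s(2) dvd_trans[of p "p ^ k" 432] by auto
  then consider "p = 2" | "p = 3" using pk(1) prime_dvd_432 by blast
  then show "s \<in> {2, 4, 8, 3, 9}"
  proof cases
    case 1
    then have "k \<in> {1, 2, 3, 4}" using s(2) pk two_power_dvd_432[of k] by auto
    then show ?thesis using 1 pk s(3) not_cyclotomic_16_dvd_mask by auto
  next
    case 2
    then have "k \<in> {1, 2, 3}" using s(2) pk three_power_dvd_432[of k] by auto
    then show ?thesis using 2 pk s(3) not_cyclotomic_27_dvd_mask by auto
  qed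
next
  fix s :: nat
  assume s: "s \<in> {2, 4, 8, 3, 9}"
  have "primepow (2 ^ Suc k :: nat)" "primepow (3 ^ Suc k :: nat)" for k
    by (simp_all del: power_Suc)
  from this(1)[of 0] this(1)[of 1] this(1)[of 2] this(2)[of 0] this(2)[of 1]
  have "primepow s" using s by auto
  moreover have "s dvd 432" using s by auto
  moreover have "cyclotomic s dvd mask_poly example_set"
  proof (rule cyclotomic_dvdI)
    fix z :: complex
    assume z: "\<And>m. z ^ m = 1 \<longleftrightarrow> s dvd m"
    have "z \<noteq> 1" using z[of 1] s by auto
    moreover have "z ^ 8 = 1 \<or> z ^ 9 = 1" unfolding z using s by auto
    ultimately show "poly (mask_poly example_set) z = 0"
      using mask_example_set_root_8 mask_example_set_root_9 by blast
  qed
  ultimately show "s \<in> prime_power_divisors 432 example_set"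
    by (simp add: prime_power_divisors_def)
qed

lemma T1_example_set: "T1 432 example_set"
proof -
  have "poly (cyclotomic 2) 1 = 2" "poly (cyclotomic 4) 1 = 2" "poly (cyclotomic 8) 1 = 2"
    "poly (cyclotomic 3) 1 = 3" "poly (cyclotomic 9) 1 = 3"
    using poly_cyclotomic_prime_power_1[of 2 0] poly_cyclotomic_prime_power_1[of 2 1]
      poly_cyclotomic_prime_power_1[of 2 2] poly_cyclotomic_prime_power_1[of 3 0]
      poly_cyclotomic_prime_power_1[of 3 1]
    by simp_all
  then show ?thesis
    by (simp add: T1_def card_example_set prime_power_divisors_example_set)
qed

lemma unsupported_divisor_example_set: "unsupported_divisor 432 example_set 432"
  unfolding unsupported_divisor_def
proof (intro conjI allI impI)
  show "p dvd card example_set" if "prime p \<and> p dvd 432" for p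
    using that prime_dvd_432 by (auto simp: card_example_set)
next
  fix p \<alpha> :: nat
  assume "prime p \<and> p dvd 432 \<and> p ^ \<alpha> dvd 432 \<and> \<not> p ^ (\<alpha> + 1) dvd 432"
  \<comment> \<open>The prime powers exactly dividing 432 are 16 and 27, the two orders already
    excluded.\<close>
  then have "p = 2 \<and> \<alpha> = 4 \<or> p = 3 \<and> \<alpha> = 3"
    using prime_dvd_432[of p] two_power_dvd_432 three_power_dvd_432
    by (auto simp del: power_Suc simp flip: Suc_eq_plus1)
  then show "\<not> cyclotomic (p ^ \<alpha>) dvd mask_poly example_set"
    using not_cyclotomic_16_dvd_mask not_cyclotomic_27_dvd_mask by auto
qed (simp_all add: cyclotomic_432_dvd_mask)

theorem theorem1p10:
  shows "\<exists>(M::nat) (A::nat set).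
    M > 0 \<and> A \<subseteq> {0..<M} \<and> A \<noteq> {} \<and>
    T1 M A \<and>
    card (prime_factors M) = 2 \<and>
    (\<exists>s. unsupported_divisor M A s)"
proof (intro exI conjI)
  have "prime_factors 432 = {2, 3::nat}"
    using prime_dvd_432 by (auto simp: prime_factors_dvd)
  then show "card (prime_factors (432::nat)) = 2" by simp
  show "example_set \<subseteq> {0..<432}"
    by (auto simp: example_set_def starts2_def starts3_def)
  show "example_set \<noteq> {}"
    using card_example_set by auto
  show "unsupported_divisor 432 example_set 432"
    by (rule unsupported_divisor_example_set)
qed (simp_all add: T1_example_set)

end
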